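(* Let $n$ be a positive integer, let $v=4n+2$, and let $X$ be a $v$-set partitioned into two subsets $\{a_0,a_1,\dots,a_{2n}\}$ and $\{b_0,b_1,\dots,b_{2n}\}$ (each of size $2n+1$). Let $G$ be the complete graph on the $2n+1$ vertices $a_0b_0,\,a_1b_1,\dots,a_{2n}b_{2n}$, and let $\mathcal{C}$ be an Eulerian cycle of $G$ (a closed walk traversing every edge of $G$ exactly once). Then $$h=\sum_{\{\alpha_0,\alpha_1,\alpha_2\}\subseteq\{0,\dots,2n\}}\begin{pmatrix} a_{\alpha_0}&a_{\alpha_1}&a_{\alpha_2}\\ b_{\alpha_0}&b_{\alpha_1}&b_{\alpha_2}\end{pmatrix}+T(\mathcal{C}),$$ where the sum runs over all $3$-element subsets of $\{0,\dots,2n\}$, is a $(2,3,4n+2)$-halving.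
   Context: Let $X$ be a $v$-set and let $\binom{X}{i}$ denote the set of $i$-subsets of $X$. Elements of $\binom{X}{k}$ are called blocks. A set $\{x_0,\dots,x_i\}$ is written as the string $x_0\cdots x_i$. A $\mathbb{Z}$-collection of blocks is a function $f:\binom{X}{k}\to\mathbb{Z}$; it is identified with the formal $\mathbb{Z}$-linear combination of blocks $\sum_{B} f(B)\,B$. Trades. For integers $0\le t\le k\le v-t$, a $\mathrm{T}(t,k,v)$ trade is a function $f:\binom{X}{k}\to\mathbb{Z}$ such that for every $A\in\binom{X}{t}$, $\sum_{B\in\binom{X}{k},\,A\subseteq B} f(B)=0$. Write $f=f_0-f_1$ with $f_0=\max(f,0)$ and $f_1=\max(-f,0)$ (the two legs). The volume of the trade is $\sum_B f_0(B)=\sum_B f_1(B)$ (the number of blocks, counted with multiplicity, in each leg). A trade is simple if it contains no repeated blocks, i.e. $f(B)\in\{-1,0,1\}$ for every block $B$. A $(t,k,v)$-halving is a simple $\mathrm{T}(t,k,v)$ trade with volume $\binom{v}{k}/2$. Notation for $k=3$. Products of distinct points denote the block consisting of these points, and products of sums are expanded multilinearly. For disjoint blocks $x_0x_1x_2$ and $y_0y_1y_2$, $$\begin{pmatrix} x_0&x_1&x_2\\ y_0&y_1&y_2\end{pmatrix}:=(x_0-y_0)(x_1-y_1)(x_2-y_2),$$ a formal combination of $8$ blocks with coefficients $\pm1$. Given a graph $G$ whose vertices are the pairs $a_ib_i$, and a cycle (closed walk without repeated edges, possibly with repeated vertices) $\mathcal{C}=(a_{i_0}b_{i_0},a_{i_1}b_{i_1},\dots,a_{i_m}b_{i_m})$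 with $i_m=i_0$ in $G$, define $$T(\mathcal{C}):=\sum_{(a_ib_i,\,a_jb_j)\in\mathcal{C}} \Big(a_ib_i(a_j+b_j)-a_jb_j(a_i+b_i)\Big),$$ where the sum is over the edges of $\mathcal{C}$ directed in the order in which $\mathcal{C}$ traverses them, i.e. over the consecutive pairs $(i,j)=(i_s,i_{s+1})$, $0\le s<m$. *)

theory Defs
  imports Complex_Main "HOL-Library.Ramsey" "HOL-Library.Function_Algebras"
begin

text \<open>
  A \<open>\<int>\<close>-collection of \<open>k\<close>-subsets of \<open>X\<close> is a function \<open>'a set \<Rightarrow> int\<close> that vanishes
  outside \<open>[X]\<^bsup>k\<^esup>\<close>. Formal sums of blocks are added pointwise, with the operations
  of \<open>Function_Algebras\<close>.
\<close>

definition trade :: "nat \<Rightarrow> nat \<Rightarrow> nat \<Rightarrow> 'a set \<Rightarrow> ('a set \<Rightarrow> int) \<Rightarrow> bool" where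
  "trade t k v X f \<longleftrightarrow>
     finite X \<and> card X = v \<and> t \<le> k \<and> k + t \<le> v \<and>
     (\<forall>B. B \<notin> [X]\<^bsup>k\<^esup> \<longrightarrow> f B = 0) \<and>
     (\<forall>A \<in> [X]\<^bsup>t\<^esup>. (\<Sum>B \<in> {B \<in> [X]\<^bsup>k\<^esup>. A \<subseteq> B}. f B) = 0)"

definition leg0 :: "('a set \<Rightarrow> int) \<Rightarrow> 'a set \<Rightarrow> int" where
  "leg0 f B = max (f B) 0"

definition leg1 :: "('a set \<Rightarrow> int) \<Rightarrow> 'a set \<Rightarrow> int" where
  "leg1 f B = max (- f B) 0"

text \<open>For a trade, either leg yields the same volume; see \<open>volume_eq_leg1\<close> below.\<close>

definition volume :: "nat \<Rightarrow> 'a set \<Rightarrow> ('a set \<Rightarrow> int) \<Rightarrow> int" where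
  "volume k X f = (\<Sum>B \<in> [X]\<^bsup>k\<^esup>. leg0 f B)"

definition simple :: "nat \<Rightarrow> 'a set \<Rightarrow> ('a set \<Rightarrow> int) \<Rightarrow> bool" where
  "simple k X f \<longleftrightarrow> (\<forall>B \<in> [X]\<^bsup>k\<^esup>. f B \<in> {-1, 0, 1})"

definition halving :: "nat \<Rightarrow> nat \<Rightarrow> nat \<Rightarrow> 'a set \<Rightarrow> ('a set \<Rightarrow> int) \<Rightarrow> bool" where
  "halving t k v X f \<longleftrightarrow>
     trade t k v X f \<and> simple k X f \<and>
     real_of_int (volume k X f) = real (v choose k) / 2"

lemma volume_eq_leg1:
  assumes "trade t k v X f"
  shows "volume k X f = (\<Sum>B \<in> [X]\<^bsup>k\<^esup>. leg1 f B)"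
proof -
  have fin: "finite X" and tk: "t \<le> k"
    and bal: "\<And>A. A \<in> [X]\<^bsup>t\<^esup> \<Longrightarrow> (\<Sum>B \<in> {B \<in> [X]\<^bsup>k\<^esup>. A \<subseteq> B}. f B) = 0"
    using assms by (auto simp: trade_def)
  have fk: "finite ([X]\<^bsup>k\<^esup>)" and ft: "finite ([X]\<^bsup>t\<^esup>)"
    using fin by (auto intro: finite_imp_finite_nsets)
  have "0 = (\<Sum>A \<in> [X]\<^bsup>t\<^esup>. \<Sum>B \<in> {B \<in> [X]\<^bsup>k\<^esup>. A \<subseteq> B}. f B)"
    using bal by simp
  also have "\<dots> = (\<Sum>B \<in> [X]\<^bsup>k\<^esup>. \<Sum>A \<in> {A \<in> [X]\<^bsup>t\<^esup>. A \<subseteq> B}. f B)"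
    by (rule sum.swap_restrict[OF ft fk])
  also have "\<dots> = (\<Sum>B \<in> [X]\<^bsup>k\<^esup>. int (k choose t) * f B)"
  proof (rule sum.cong[OF refl])
    fix B assume B: "B \<in> [X]\<^bsup>k\<^esup>"
    have "{A \<in> [X]\<^bsup>t\<^esup>. A \<subseteq> B} = {A. A \<subseteq> B \<and> card A = t}"
      using B by (auto simp: nsets_def intro: finite_subset)
    moreover have "card {A. A \<subseteq> B \<and> card A = t} = (k choose t)"
      using B by (simp add: nsets_def n_subsets)
    ultimately show "(\<Sum>A \<in> {A \<in> [X]\<^bsup>t\<^esup>. A \<subseteq> B}. f B) = int (k choose t) * f B"
      by simp
  qed
  also have "\<dots> = int (k choose t) * (\<Sum>B \<in> [X]\<^bsup>k\<^esup>. f B)"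
    by (simp add: sum_distrib_left)
  finally have "(\<Sum>B \<in> [X]\<^bsup>k\<^esup>. f B) = 0"
    using tk by simp
  moreover have "f B = leg0 f B - leg1 f B" for B
    by (simp add: leg0_def leg1_def max_def)
  ultimately show ?thesis
    by (simp add: volume_def sum_subtractf)
qed

text \<open>
  The multilinear product of formal sums of sets: a product of disjoint sets is
  their union. Products of sets that meet are dropped; they do not occur
  in the expressions below as long as the points involved are distinct.
\<close>

definition pt :: "'a \<Rightarrow> 'a set \<Rightarrow> int" where
  "pt x B = (if B = {x} then 1 else 0)"

definition bprod :: "('a set \<Rightarrow> int) \<Rightarrow> ('a set \<Rightarrow> int) \<Rightarrow> 'a set \<Rightarrow> int"
    (infixl \<open>\<odot>\<close> 70) where
  "(f \<odot> g) B = (\<Sum>C \<in> Pow B. f C * g (B - C))"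

lemma pt_bprod_block:
  assumes "finite S" "x \<notin> S"
  shows "pt x \<odot> (\<lambda>B. if B = S then 1 else 0) = (\<lambda>B. if B = insert x S then 1 else 0)"
proof
  fix B :: "'a set"
  have *: "pt x C * (if B - C = S then 1 else 0)
      = (if C = {x} then if B = insert x S then 1 else 0 else 0)" if "C \<in> Pow B" for C
    using that assms by (auto simp: pt_def)
  have "(pt x \<odot> (\<lambda>B. if B = S then 1 else 0)) B
      = (\<Sum>C \<in> Pow B. if C = {x} then if B = insert x S then 1 else 0 else 0)"
    unfolding bprod_def by (rule sum.cong[OF refl *])
  also have "\<dots> = (if B = insert x S then 1 else 0)"
    using assms by (cases "finite B") auto
  finally show "(pt x \<odot> (\<lambda>B. if B = S then 1 else 0)) B = (if B = insert x S then 1 else 0)" .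
qed

definition bracket :: "'a \<Rightarrow> 'a \<Rightarrow> 'a \<Rightarrow> 'a \<Rightarrow> 'a \<Rightarrow> 'a \<Rightarrow> 'a set \<Rightarrow> int" where
  "bracket x0 x1 x2 y0 y1 y2 = (pt x0 - pt y0) \<odot> (pt x1 - pt y1) \<odot> (pt x2 - pt y2)"

text \<open>
  A simple graph is given by its vertex set \<open>V\<close> and a set \<open>E\<close> of 2-subsets of \<open>V\<close>,
  a walk by the list of its \<open>m + 1\<close> vertices; \<open>steps\<close> are its \<open>m\<close> directed edges.
\<close>

definition complete_edges :: "'v set \<Rightarrow> 'v set set" where
  "complete_edges V = [V]\<^bsup>2\<^esup>"

definition steps :: "'v list \<Rightarrow> ('v \<times> 'v) list" where
  "steps C = zip C (tl C)"

definition walk_edges :: "'v list \<Rightarrow> 'v set list" where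
  "walk_edges C = map (\<lambda>(p, q). {p, q}) (steps C)"

definition cycle :: "'v set \<Rightarrow> 'v set set \<Rightarrow> 'v list \<Rightarrow> bool" where
  "cycle V E C \<longleftrightarrow>
     C \<noteq> [] \<and> set C \<subseteq> V \<and> set (walk_edges C) \<subseteq> E \<and> last C = hd C \<and> distinct (walk_edges C)"

definition eulerian_cycle :: "'v set \<Rightarrow> 'v set set \<Rightarrow> 'v list \<Rightarrow> bool" where
  "eulerian_cycle V E C \<longleftrightarrow> cycle V E C \<and> set (walk_edges C) = E"

definition edge_term :: "'a \<times> 'a \<Rightarrow> 'a \<times> 'a \<Rightarrow> 'a set \<Rightarrow> int" where
  "edge_term p q =
     pt (fst p) \<odot> pt (snd p) \<odot> (pt (fst q) + pt (snd q)) -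
     pt (fst q) \<odot> pt (snd q) \<odot> (pt (fst p) + pt (snd p))"

definition cycle_sum :: "('a \<times> 'a) list \<Rightarrow> 'a set \<Rightarrow> int" where
  "cycle_sum C = (\<Sum>(p, q) \<leftarrow> steps C. edge_term p q)"

end

theory Submission
  imports Defs
begin

text \<open>
  Every block meets either three of the pairs \<open>{a\<^sub>i, b\<^sub>i}\<close>, and then it gets a coefficient \<open>\<plusminus>1\<close> from
  exactly one bracket and none from an edge, or exactly two of them, and then it gets a
  coefficient \<open>\<plusminus>1\<close> from exactly one edge of the Eulerian cycle and none from a bracket.
  Each bracket is a trade by itself. An edge \<open>(p, q)\<close> contributes to the balance at a
  2-set \<open>A\<close> the amount \<open>2[A = p] - 2[A = q]\<close>, which telescopes to 0 along a closed walk.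
  A trade with all coefficients \<open>\<plusminus>1\<close> has volume half the number of blocks.
\<close>

section \<open>Formal products expanded into indicators of single blocks\<close>

definition block :: "'a set \<Rightarrow> 'a set \<Rightarrow> int" where
  "block S B = of_bool (B = S)"

lemma pt_eq_block: "pt x = block {x}"
  by (auto simp: pt_def block_def fun_eq_iff)

text \<open>Only the summand \<open>C = S\<close> survives, and by disjointness the conditions
  \<open>S \<subseteq> B\<close> and \<open>B - S = T\<close> amount to
  \<open>B = S \<union> T\<close>. Finiteness matters: for infinite \<open>B\<close> the sum over
  \<open>Pow B\<close> is 0 by default.\<close>

lemma block_bprod_block:
  assumes "finite S" "finite T" "S \<inter> T = {}"
  shows "block S \<odot> block T = block (S \<union> T)"
proof
  fix B
  have *: "block S C * block T (B - C) = (if C = S then of_bool (B = S \<union> T) else 0)"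
    if "C \<in> Pow B" for C
    using that assms by (auto simp: block_def)
  have "(block S \<odot> block T) B = (\<Sum>C \<in> Pow B. if C = S then of_bool (B = S \<union> T) else 0)"
    unfolding bprod_def by (rule sum.cong[OF refl *])
  also have "\<dots> = block (S \<union> T) B"
    using assms by (cases "finite B") (auto simp: block_def)
  finally show "(block S \<odot> block T) B = block (S \<union> T) B" .
qed

lemma bprod_diff_left: "(f - g) \<odot> h = f \<odot> h - g \<odot> h"
  by (simp add: fun_eq_iff bprod_def left_diff_distrib sum_subtractf)

lemma bprod_diff_right: "f \<odot> (g - h) = f \<odot> g - f \<odot> h"
  by (simp add: fun_eq_iff bprod_def right_diff_distrib sum_subtractf)

lemma bprod_add_right: "f \<odot> (g + h) = f \<odot> g + f \<odot> h"
  by (simp add: fun_eq_iff bprod_def distrib_left sum.distrib)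

lemmas bprod_simps =
  pt_eq_block bprod_diff_left bprod_diff_right bprod_add_right block_bprod_block insert_commute

lemma bracket_eq:
  assumes "distinct [x0, x1, x2, y0, y1, y2]"
  shows "bracket x0 x1 x2 y0 y1 y2 =
    block {x0, x1, x2} - block {x0, x1, y2} - block {x0, y1, x2} + block {x0, y1, y2}
    - block {y0, x1, x2} + block {y0, x1, y2} + block {y0, y1, x2} - block {y0, y1, y2}"
  using assms by (simp add: bracket_def bprod_simps)

lemma edge_term_eq:
  assumes "distinct [p1, p2, q1, q2]"
  shows "edge_term (p1, p2) (q1, q2) =
    block {p1, p2, q1} + block {p1, p2, q2} - block {q1, q2, p1} - block {q1, q2, p2}"
  using assms by (simp add: edge_term_def bprod_simps)

section \<open>Supports and coefficients of brackets and edge terms\<close>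

lemma transversal_eq_iff:
  assumes "distinct [x0, x1, x2, y0, y1, y2]"
    and "z0 \<in> {x0, y0}" "z1 \<in> {x1, y1}" "z2 \<in> {x2, y2}"
    and "w0 \<in> {x0, y0}" "w1 \<in> {x1, y1}" "w2 \<in> {x2, y2}"
  shows "{z0, z1, z2} = {w0, w1, w2} \<longleftrightarrow> z0 = w0 \<and> z1 = w1 \<and> z2 = w2"
proof
  assume "{z0, z1, z2} = {w0, w1, w2}"
  then have "z0 \<in> {w0, w1, w2}" "z1 \<in> {w0, w1, w2}" "z2 \<in> {w0, w1, w2}" by blast+
  \<comment> \<open>The three pairs are disjoint, so \<open>z0\<close> can only coincide with
    \<open>w0\<close>; likewise for the other two positions.\<close>
  moreover have "z0 \<noteq> w1" "z0 \<noteq> w2" using assms(1,2,6,7) by auto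
  moreover have "z1 \<noteq> w0" "z1 \<noteq> w2" using assms(1,3,5,7) by auto
  moreover have "z2 \<noteq> w0" "z2 \<noteq> w1" using assms(1,4,5,6) by auto
  ultimately show "z0 = w0 \<and> z1 = w1 \<and> z2 = w2" by simp
qed simp

text \<open>The indicator of each of the eight blocks splits over the three pairs, so the
  coefficient is a product of three signs: +1 where the chosen point is an x, -1 where it is a
  y.\<close>

lemma bracket_transversal:
  assumes d: "distinct [x0, x1, x2, y0, y1, y2]"
    and z: "z0 \<in> {x0, y0}" "z1 \<in> {x1, y1}" "z2 \<in> {x2, y2}"
  shows "bracket x0 x1 x2 y0 y1 y2 {z0, z1, z2} \<in> {-1, 1}"
proof -
  have "block {w0, w1, w2} {z0, z1, z2} = of_bool (z0 = w0) * (of_bool (z1 = w1) * of_bool (z2 = w2))"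
    if "w0 \<in> {x0, y0}" "w1 \<in> {x1, y1}" "w2 \<in> {x2, y2}" for w0 w1 w2
    unfolding block_def transversal_eq_iff[OF d z that] of_bool_conj ..
  then have "bracket x0 x1 x2 y0 y1 y2 {z0, z1, z2} = (of_bool (z0 = x0) - of_bool (z0 = y0)) *
    ((of_bool (z1 = x1) - of_bool (z1 = y1)) * (of_bool (z2 = x2) - of_bool (z2 = y2)))"
    unfolding bracket_eq[OF d] plus_fun_apply minus_apply left_diff_distrib right_diff_distrib
    by simp
  moreover have "u * v \<in> {-1, 1}" if "u \<in> {-1, 1}" "v \<in> {-1, 1}" for u v :: int
    using that by auto
  moreover have "of_bool (z0 = x0) - of_bool (z0 = y0) \<in> {-1, 1 :: int}"
    "of_bool (z1 = x1) - of_bool (z1 = y1) \<in> {-1, 1 :: int}"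
    "of_bool (z2 = x2) - of_bool (z2 = y2) \<in> {-1, 1 :: int}"
    using z d by auto
  ultimately show ?thesis by presburger
qed

lemma bracket_nonzeroE:
  assumes d: "distinct [x0, x1, x2, y0, y1, y2]"
    and "bracket x0 x1 x2 y0 y1 y2 B \<noteq> 0"
  obtains z0 z1 z2 where "B = {z0, z1, z2}"
    "z0 \<in> {x0, y0}" "z1 \<in> {x1, y1}" "z2 \<in> {x2, y2}"
proof -
  have "\<exists>z0\<in>{x0, y0}. \<exists>z1\<in>{x1, y1}. \<exists>z2\<in>{x2, y2}. B = {z0, z1, z2}"
    using assms(2) unfolding bracket_eq[OF d] plus_fun_apply minus_apply block_def
    by (rule contrapos_np) simp
  then show ?thesis by (elim bexE) (rule that)
qed

text \<open>Because of this antisymmetry, the direction in which the cycle runs through an edge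
  affects only the sign of a coefficient.\<close>

lemma edge_term_swap: "edge_term q p = - edge_term p q"
  by (simp add: edge_term_def)

text \<open>The second positive block differs in its q-point, and each negative block contains only
  one point of the pair p, so a single indicator is nonzero. The coefficients -1 come from
  exchanging p and q.\<close>

lemma edge_term_block:
  assumes d: "distinct [p1, p2, q1, q2]" and z: "z \<in> {q1, q2}"
  shows "edge_term (p1, p2) (q1, q2) {p1, p2, z} = 1"
proof -
  have "q1 \<notin> {p1, p2, q2}" "p2 \<notin> {q1, q2, p1}" "p1 \<notin> {q1, q2, p2}"
    using d by auto
  then have "{p1, p2, q1} \<noteq> {p1, p2, q2}" "{p1, p2, z} \<noteq> {q1, q2, p1}" "{p1, p2, z} \<noteq> {q1, q2, p2}"
    by blast+
  then show ?thesis
    using z unfolding edge_term_eq[OF d] by (auto simp: block_def)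
qed

lemma edge_term_nonzeroE:
  assumes d: "distinct [p1, p2, q1, q2]"
    and "edge_term (p1, p2) (q1, q2) B \<noteq> 0"
  obtains z where "z \<in> {q1, q2}" "B = {p1, p2, z}" | z where "z \<in> {p1, p2}" "B = {q1, q2, z}"
proof -
  have "(\<exists>z\<in>{q1, q2}. B = {p1, p2, z}) \<or> (\<exists>z\<in>{p1, p2}. B = {q1, q2, z})"
    using assms(2) unfolding edge_term_eq[OF d] plus_fun_apply minus_apply block_def
    by (rule contrapos_np) simp
  then show ?thesis by (elim disjE bexE) (rule that; assumption)+
qed

section \<open>Balance of brackets and edge terms over the blocks through a 2-set\<close>

lemma sum_block:
  assumes "finite X" "S \<in> [X]\<^bsup>k\<^esup>"
  shows "(\<Sum>B \<in> {B \<in> [X]\<^bsup>k\<^esup>. A \<subseteq> B}. block S B) = of_bool (A \<subseteq> S)"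
proof -
  have "finite {B \<in> [X]\<^bsup>k\<^esup>. A \<subseteq> B}"
    using assms by (simp add: finite_imp_finite_nsets)
  then show ?thesis
    using assms(2) by (simp add: block_def of_bool_def)
qed

lemma nsets_3_I: "x \<in> X \<Longrightarrow> y \<in> X \<Longrightarrow> z \<in> X \<Longrightarrow> distinct [x, y, z] \<Longrightarrow> {x, y, z} \<in> [X]\<^bsup>3\<^esup>"
  by (simp add: nsets_def)

text \<open>By counting, a 2-set misses one of the three pairs entirely. Exchanging the two points
  of that pair matches the blocks through \<open>A\<close> with blocks through \<open>A\<close> of
  opposite sign.\<close>

lemma bracket_balanced:
  assumes X: "finite X" "{x0, x1, x2, y0, y1, y2} \<subseteq> X"
    and d: "distinct [x0, x1, x2, y0, y1, y2]"
    and A: "card A = 2"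
  shows "(\<Sum>B \<in> {B \<in> [X]\<^bsup>3\<^esup>. A \<subseteq> B}. bracket x0 x1 x2 y0 y1 y2 B) = 0"
proof -
  have sums: "(\<Sum>B \<in> {B \<in> [X]\<^bsup>3\<^esup>. A \<subseteq> B}. block {z0, z1, z2} B) = of_bool (A \<subseteq> {z0, z1, z2})"
    if "z0 \<in> {x0, y0}" "z1 \<in> {x1, y1}" "z2 \<in> {x2, y2}" for z0 z1 z2
    by (rule sum_block[OF X(1) nsets_3_I]) (use that X(2) d in auto)
  have sum_eq: "(\<Sum>B \<in> {B \<in> [X]\<^bsup>3\<^esup>. A \<subseteq> B}. bracket x0 x1 x2 y0 y1 y2 B) =
    of_bool (A \<subseteq> {x0, x1, x2}) - of_bool (A \<subseteq> {x0, x1, y2})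
    - of_bool (A \<subseteq> {x0, y1, x2}) + of_bool (A \<subseteq> {x0, y1, y2})
    - of_bool (A \<subseteq> {y0, x1, x2}) + of_bool (A \<subseteq> {y0, x1, y2})
    + of_bool (A \<subseteq> {y0, y1, x2}) - of_bool (A \<subseteq> {y0, y1, y2})"
    unfolding bracket_eq[OF d] plus_fun_apply minus_apply sum.distrib sum_subtractf
    by (simp add: sums)
  have "(x0 \<notin> A \<and> y0 \<notin> A) \<or> (x1 \<notin> A \<and> y1 \<notin> A) \<or> (x2 \<notin> A \<and> y2 \<notin> A)"
  proof (rule ccontr)
    assume "\<not> ?thesis"
    then obtain z0 z1 z2 where z: "z0 \<in> {x0, y0}" "z1 \<in> {x1, y1}" "z2 \<in> {x2, y2}"
      and sub: "{z0, z1, z2} \<subseteq> A" by blast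
    have "z0 \<noteq> z1" using d z(1,2) by auto
    moreover have "z0 \<noteq> z2" using d z(1,3) by auto
    moreover have "z1 \<noteq> z2" using d z(2,3) by auto
    ultimately have "card {z0, z1, z2} = 3" by simp
    moreover have "card {z0, z1, z2} \<le> card A"
      using A sub by (intro card_mono) (auto intro: card_ge_0_finite)
    ultimately show False using A by simp
  qed
  \<comment> \<open>Deleting a point outside \<open>A\<close> from a block does not affect whether
    it contains \<open>A\<close>. After deleting the points of the missed pair, the cancelling terms
    are literally equal.\<close>
  moreover have "A \<subseteq> {u, w, z} \<longleftrightarrow> A \<subseteq> {u, z}" "A \<subseteq> {u, z, w} \<longleftrightarrow> A \<subseteq> {u, z}"
    if "w \<notin> A" for u w z
    using that by blast+
  ultimately show ?thesis
    unfolding sum_eq by (elim disjE) (simp_all add: subset_insert)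
qed

lemma of_bool_subset_3:
  assumes "card A = 2" "distinct [x, y, z]"
  shows "(of_bool (A \<subseteq> {x, y, z}) :: int) =
    of_bool (A = {x, y}) + of_bool (A = {x, z}) + of_bool (A = {y, z})"
proof -
  obtain u w where "A = {u, w}" "u \<noteq> w"
    using assms(1) by (auto simp: card_2_iff)
  then show ?thesis
    using assms(2) by (auto simp: doubleton_eq_iff)
qed

text \<open>The pair p lies in both positive blocks and the pair q in both negative ones. A mixed
  pair lies in one positive and one negative block and cancels.\<close>

lemma edge_term_balance:
  assumes X: "finite X" "{p1, p2, q1, q2} \<subseteq> X"
    and d: "distinct [p1, p2, q1, q2]"
    and A: "card A = 2"
  shows "(\<Sum>B \<in> {B \<in> [X]\<^bsup>3\<^esup>. A \<subseteq> B}. edge_term (p1, p2) (q1, q2) B) =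
    2 * of_bool (A = {p1, p2}) - 2 * of_bool (A = {q1, q2})"
proof -
  have sum_eq: "(\<Sum>B \<in> {B \<in> [X]\<^bsup>3\<^esup>. A \<subseteq> B}. edge_term (p1, p2) (q1, q2) B) =
    of_bool (A \<subseteq> {p1, p2, q1}) + of_bool (A \<subseteq> {p1, p2, q2})
    - of_bool (A \<subseteq> {q1, q2, p1}) - of_bool (A \<subseteq> {q1, q2, p2})"
    using X d unfolding edge_term_eq[OF d] plus_fun_apply minus_apply sum.distrib sum_subtractf
    by (subst (1 2 3 4) sum_block) (auto intro!: nsets_3_I)
  show ?thesis
    unfolding sum_eq using d A by (simp add: of_bool_subset_3 insert_commute)
qed

section \<open>Sums along walks, the halving criterion and increasing triples\<close>

lemma sum_list_steps_telescope:
  fixes g :: "'v \<Rightarrow> int"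
  assumes "C \<noteq> []"
  shows "(\<Sum>(p, q) \<leftarrow> steps C. g p - g q) = g (hd C) - g (last C)"
  using assms by (induction C rule: induct_list012) (auto simp: steps_def)

lemma sum_fun_apply: "(\<Sum>s \<in> S. f s) x = (\<Sum>s \<in> S. f s x)"
  by (induction S rule: infinite_finite_induct) auto

lemma sum_list_fun_apply: "(\<Sum>s \<leftarrow> xs. f s) x = (\<Sum>s \<leftarrow> xs. f s x)"
  by (induction xs) auto

lemma sum_sum_list_swap:
  "(\<Sum>x \<in> S. \<Sum>y \<leftarrow> ys. f x y) = (\<Sum>y \<leftarrow> ys. \<Sum>x \<in> S. f x y)"
  by (induction ys) (auto simp: sum.distrib)

text \<open>On each block the two legs add up to the absolute value of the coefficient, here 1.
  Since both legs have the same total, twice the volume is the number of blocks.\<close>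

lemma halvingI:
  assumes tr: "trade t k v X f" and pm: "\<And>B. B \<in> [X]\<^bsup>k\<^esup> \<Longrightarrow> f B \<in> {-1, 1}"
  shows "halving t k v X f"
proof -
  have "2 * volume k X f = (\<Sum>B \<in> [X]\<^bsup>k\<^esup>. leg0 f B) + (\<Sum>B \<in> [X]\<^bsup>k\<^esup>. leg1 f B)"
    using volume_eq_leg1[OF tr] by (simp add: volume_def)
  also have "\<dots> = (\<Sum>B \<in> [X]\<^bsup>k\<^esup>. 1)"
    unfolding sum.distrib[symmetric]
    by (rule sum.cong[OF refl]) (use pm in \<open>force simp: leg0_def leg1_def\<close>)
  also have "\<dots> = int (v choose k)"
    using tr by (simp add: trade_def)
  finally have "2 * real_of_int (volume k X f) = real (v choose k)"
    by (metis of_int_mult of_int_numeral of_int_of_nat_eq)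
  then show ?thesis
    using tr pm by (auto simp: halving_def simple_def)
qed

text \<open>Brackets are indexed by increasing triples in place of 3-subsets of indices. This lemma
  finds the triple of a given 3-subset; \<open>sorted_triple_eqD\<close> makes it unique.\<close>

lemma card_3_nat_sorted:
  assumes "card (S :: nat set) = 3"
  obtains i j k where "S = {i, j, k}" "i < j" "j < k"
proof -
  have f: "finite S" using assms by (simp add: card_ge_0_finite)
  define xs where "xs = sorted_list_of_set S"
  have "length xs = 3" "set xs = S" "sorted_wrt (<) xs"
    using assms f by (auto simp: xs_def)
  moreover obtain i j k where "xs = [i, j, k]"
    using \<open>length xs = 3\<close> by (auto simp: length_Suc_conv numeral_3_eq_3)
  ultimately show ?thesis
    by (intro that[of i j k]) auto
qed

lemma sorted_triple_eqD:
  fixes i j k :: nat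
  assumes "{i, j, k} = {i', j', k'}" "i < j" "j < k" "i' < j'" "j' < k'"
  shows "i = i'" "j = j'" "k = k'"
proof -
  have "[i, j, k] = [i', j', k']"
    by (rule sorted_distinct_set_unique) (use assms in auto)
  then show "i = i'" "j = j'" "k = k'" by simp_all
qed

theorem theorem2p1:
  fixes n v :: nat
    and X :: "'a set"
    and a b :: "nat \<Rightarrow> 'a"
    and V :: "('a \<times> 'a) set"
    and C :: "('a \<times> 'a) list"
    and h :: "'a set \<Rightarrow> int"
  assumes "n > 0"
    and "v = 4 * n + 2"
    and "finite X" and "card X = v"
    and "X = a ` {0..2 * n} \<union> b ` {0..2 * n}"
    and "a ` {0..2 * n} \<inter> b ` {0..2 * n} = {}"
    and "inj_on a {0..2 * n}" and "inj_on b {0..2 * n}"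
    and "V = (\<lambda>i. (a i, b i)) ` {0..2 * n}"
    and "eulerian_cycle V (complete_edges V) C"
    and "h = (\<Sum>(i, j, k) \<in> {(i, j, k). i < j \<and> j < k \<and> k \<le> 2 * n}.
                bracket (a i) (a j) (a k) (b i) (b j) (b k))
             + cycle_sum C"
  shows "halving 2 3 v X h"
proof -

  \<comment> \<open>Indices of points, and the shape of the steps of the cycle\<close>
  define I where "I = {0..2 * n}"
  define T where "T = {(i, j, k). i < j \<and> j < k \<and> k \<le> 2 * n}"
  define br where "br = (\<lambda>(i, j, k). bracket (a i) (a j) (a k) (b i) (b j) (b k))"
  \<comment> \<open>For a point of \<open>X\<close>, \<open>\<pi>\<close> returns the index of the
    pair containing it. The size of the image of a block, 3 or 2, tells whether a bracket or an edge
    accounts for it.\<close>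
  define \<pi> where "\<pi> x = (if x \<in> a ` I then the_inv_into I a x else the_inv_into I b x)" for x
  have inj: "inj_on a I" "inj_on b I" and disj: "a ` I \<inter> b ` I = {}" and X: "X = a ` I \<union> b ` I"
    using assms by (simp_all add: I_def)
  have \<pi>a [simp]: "\<pi> (a i) = i" and \<pi>b [simp]: "\<pi> (b i) = i" if "i \<in> I" for i
    using that inj disj by (auto simp: \<pi>_def the_inv_into_f_f)
  have dist: "distinct [a i, b i]" if "i \<in> I" for i
    using that disj by auto
  have ne: "a i \<noteq> a j \<and> a i \<noteq> b j \<and> b i \<noteq> a j \<and> b i \<noteq> b j" if "i \<in> I" "j \<in> I" "i \<noteq> j" for i j
    using \<pi>a[OF that(1)] \<pi>b[OF that(1)] \<pi>a[OF that(2)] \<pi>b[OF that(2)] that(3) by metis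
  have d3: "distinct [a i, a j, a k, b i, b j, b k]"
    if "i \<in> I" "j \<in> I" "k \<in> I" "i \<noteq> j" "i \<noteq> k" "j \<noteq> k" for i j k
    using dist[OF that(1)] dist[OF that(2)] dist[OF that(3)]
      ne[OF that(1,2,4)] ne[OF that(1,3,5)] ne[OF that(2,3,6)]
    by simp metis
  have d2: "distinct [a i, b i, a j, b j]" if "i \<in> I" "j \<in> I" "i \<noteq> j" for i j
    using dist[OF that(1)] dist[OF that(2)] ne[OF that] by simp
  have finT: "finite T"
    by (rule finite_subset[of _ "{0..2 * n} \<times> {0..2 * n} \<times> {0..2 * n}"]) (auto simp: T_def)
  have h: "h B = (\<Sum>t \<in> T. br t B) + (\<Sum>(p, q) \<leftarrow> steps C. edge_term p q B)" for B
    by (simp add: assms(11) T_def br_def cycle_sum_def sum_fun_apply sum_list_fun_apply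
        case_prod_unfold)

  have C: "C \<noteq> []" "last C = hd C" "distinct (walk_edges C)" "set (walk_edges C) = [V]\<^bsup>2\<^esup>"
    using assms(10) by (auto simp: eulerian_cycle_def cycle_def complete_edges_def)
  \<comment> \<open>Edges are 2-sets of vertices, so no step is a loop and its two ends have
    different indices.\<close>
  have stepE: "\<exists>i j. i \<in> I \<and> j \<in> I \<and> i \<noteq> j \<and> s = ((a i, b i), (a j, b j))"
    if "s \<in> set (steps C)" for s
  proof -
    have "{fst s, snd s} \<in> [V]\<^bsup>2\<^esup>"
      using that unfolding C(4)[symmetric] walk_edges_def case_prod_unfold set_map by (rule imageI)
    then have "fst s \<in> V" "snd s \<in> V" "fst s \<noteq> snd s"
      by (auto simp: nsets_def card_2_iff doubleton_eq_iff)
    moreover from this obtain i j where "i \<in> I" "j \<in> I" "fst s = (a i, b i)" "snd s = (a j, b j)"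
      unfolding assms(9) I_def by blast
    ultimately show ?thesis
      by (metis prod.collapse)
  qed

  \<comment> \<open>Index sets of the blocks occurring in brackets and edge terms\<close>
  have br_supp: "\<exists>z0 z1 z2. B = {z0, z1, z2} \<and> z0 \<in> {a i, b i} \<and> z1 \<in> {a j, b j} \<and> z2 \<in> {a k, b k}"
    if "(i, j, k) \<in> T" "br (i, j, k) B \<noteq> 0" for i j k B
  proof -
    have "distinct [a i, a j, a k, b i, b j, b k]"
      using that(1) by (intro d3) (auto simp: T_def I_def)
    from bracket_nonzeroE[OF this] show ?thesis
      using that(2) unfolding br_def prod.case by metis
  qed
  \<comment> \<open>The index set of a block determines its bracket. This separates the brackets
    from each other and, by the size 3, from the edge terms.\<close>
  have br_\<pi>: "\<pi> ` B = {i, j, k}" if "(i, j, k) \<in> T" "br (i, j, k) B \<noteq> 0" for i j k B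
  proof -
    have "i \<in> I" "j \<in> I" "k \<in> I" using that(1) by (auto simp: T_def I_def)
    with br_supp[OF that] show ?thesis by auto
  qed
  have e_\<pi>: "\<pi> ` B = {i, j}"
    if "i \<in> I" "j \<in> I" "i \<noteq> j" "edge_term (a i, b i) (a j, b j) B \<noteq> 0" for i j B
    using edge_term_nonzeroE[OF d2[OF that(1-3)] that(4)] that(1,2) by cases auto

  \<comment> \<open>Each summand of \<open>h\<close> is supported on sets of three distinct points
    of \<open>X\<close>.\<close>
  have outside: "h B = 0" if B: "B \<notin> [X]\<^bsup>3\<^esup>" for B
  proof -
    have "br t B = 0" if t: "t \<in> T" for t
    proof (rule ccontr)
      assume nz: "br t B \<noteq> 0"
      obtain i j k where t: "t = (i, j, k)" "(i, j, k) \<in> T" using t by (cases t) auto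
      have I: "i \<in> I" "j \<in> I" "k \<in> I" "i \<noteq> j" "i \<noteq> k" "j \<noteq> k"
        using t by (auto simp: T_def I_def)
      from br_supp[OF t(2)] nz t(1) obtain z0 z1 z2 where z:
        "B = {z0, z1, z2}" "z0 \<in> {a i, b i}" "z1 \<in> {a j, b j}" "z2 \<in> {a k, b k}" by blast
      have "B \<in> [X]\<^bsup>3\<^esup>"
        unfolding z(1) by (rule nsets_3_I) (use z d3[OF I] I X in auto)
      with B show False by simp
    qed
    moreover have "edge_term p q B = 0" if s: "(p, q) \<in> set (steps C)" for p q
    proof (rule ccontr)
      assume nz: "edge_term p q B \<noteq> 0"
      obtain i j where I: "i \<in> I" "j \<in> I" "i \<noteq> j" and "p = (a i, b i)" "q = (a j, b j)"
        using stepE[OF s] by auto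
      with nz have nz: "edge_term (a i, b i) (a j, b j) B \<noteq> 0" by simp
      have "B \<in> [X]\<^bsup>3\<^esup>"
        using edge_term_nonzeroE[OF d2[OF I] nz]
      proof cases
        case (1 z)
        show ?thesis unfolding 1 by (rule nsets_3_I) (use 1 d2[OF I] I X in auto)
      next
        case (2 z)
        show ?thesis unfolding 2 by (rule nsets_3_I) (use 2 d2[OF I] I X in auto)
      qed
      with B show False by simp
    qed
    ultimately show ?thesis
      unfolding h by (auto intro!: sum_list_0 simp: case_prod_unfold cong: map_cong)
  qed

  \<comment> \<open>Balance of \<open>h\<close> at every 2-set\<close>
  have bal: "(\<Sum>B \<in> {B \<in> [X]\<^bsup>3\<^esup>. A \<subseteq> B}. h B) = 0" if A: "A \<in> [X]\<^bsup>2\<^esup>" for A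
  proof -
    let ?F = "{B \<in> [X]\<^bsup>3\<^esup>. A \<subseteq> B}"
    have card: "card A = 2" using A by (simp add: nsets_def)
    have "(\<Sum>B \<in> ?F. br t B) = 0" if t: "t \<in> T" for t
    proof -
      obtain i j k where t: "t = (i, j, k)" "(i, j, k) \<in> T" using t by (cases t) auto
      have I: "i \<in> I" "j \<in> I" "k \<in> I" "i \<noteq> j" "i \<noteq> k" "j \<noteq> k"
        using t by (auto simp: T_def I_def)
      show ?thesis
        unfolding t(1) br_def prod.case
        by (rule bracket_balanced[OF assms(3) _ d3[OF I] card]) (use I X in auto)
    qed
    then have 1: "(\<Sum>B \<in> ?F. \<Sum>t \<in> T. br t B) = 0"
      by (subst sum.swap) simp
    \<comment> \<open>A potential on the vertices: by \<open>edge_term_balance\<close> each step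
      contributes the difference of its values at the two ends, and these differences cancel around
      the closed walk.\<close>
    define g :: "'a \<times> 'a \<Rightarrow> int" where "g p = 2 * of_bool (A = {fst p, snd p})" for p
    have "(\<Sum>B \<in> ?F. edge_term p q B) = g p - g q" if s: "(p, q) \<in> set (steps C)" for p q
    proof -
      obtain i j where I: "i \<in> I" "j \<in> I" "i \<noteq> j" and pq: "p = (a i, b i)" "q = (a j, b j)"
        using stepE[OF s] by auto
      show ?thesis
        unfolding pq g_def fst_conv snd_conv
        by (rule edge_term_balance[OF assms(3) _ d2[OF I] card]) (use I X in auto)
    qed
    then have "(\<Sum>B \<in> ?F. \<Sum>(p, q) \<leftarrow> steps C. edge_term p q B) = (\<Sum>(p, q) \<leftarrow> steps C. g p - g q)"
      unfolding case_prod_unfold sum_sum_list_swap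
      by (intro arg_cong[of _ _ sum_list] map_cong) auto
    also have "\<dots> = 0"
      using sum_list_steps_telescope[OF C(1), of g] C(2) by simp
    finally show ?thesis
      unfolding h sum.distrib 1 by simp
  qed

  have tr: "trade 2 3 v X h"
    using assms(1-4) outside bal by (auto simp: trade_def)

  \<comment> \<open>Every block has coefficient 1 or -1 in \<open>h\<close>\<close>
  have pm: "h B \<in> {-1, 1}" if B: "B \<in> [X]\<^bsup>3\<^esup>" for B
  proof -
    have fB: "finite B" "card B = 3" "B \<subseteq> X" using B by (auto simp: nsets_def)
    have \<pi>x: "x \<in> {a (\<pi> x), b (\<pi> x)}" "\<pi> x \<in> I" if "x \<in> B" for x
      using that fB X by auto
    have \<pi>I: "\<pi> ` B \<subseteq> I" using \<pi>x(2) by (rule image_subsetI)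
    have cover: "B \<subseteq> (\<Union>i \<in> \<pi> ` B. {a i, b i})"
      using \<pi>x(1) by (intro subsetI UN_I) auto
    have "card (\<pi> ` B) \<le> 3" using card_image_le[OF fB(1), of \<pi>] fB by simp
    moreover have "\<pi> ` B \<noteq> {}" using fB by auto
    \<comment> \<open>A single index would confine the three points of \<open>B\<close> to one
      pair.\<close>
    moreover have "card (\<pi> ` B) \<noteq> 1"
    proof
      assume "card (\<pi> ` B) = 1"
      then obtain i where "\<pi> ` B = {i}" by (elim card_1_singletonE)
      then have "B \<subseteq> {a i, b i}" using cover by simp
      then have "card B \<le> card {a i, b i}" by (intro card_mono) auto
      also have "\<dots> \<le> 2" by (simp add: card_insert_if)
      finally show False using fB by simp
    qed
    moreover have "card (\<pi> ` B) \<noteq> 0" using \<open>\<pi> ` B \<noteq> {}\<close> fB by simp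
    ultimately consider "card (\<pi> ` B) = 3" | "card (\<pi> ` B) = 2" by linarith
    then show ?thesis
    proof cases
      case 1
      obtain i j k where ijk: "\<pi> ` B = {i, j, k}" "i < j" "j < k"
        using card_3_nat_sorted[OF 1] .
      have I: "i \<in> I" "j \<in> I" "k \<in> I" "i \<noteq> j" "i \<noteq> k" "j \<noteq> k"
        using \<pi>I ijk(2,3) unfolding ijk(1) by simp_all
      have T: "(i, j, k) \<in> T" using I ijk by (auto simp: T_def I_def)
      have "i \<in> \<pi> ` B" "j \<in> \<pi> ` B" "k \<in> \<pi> ` B" using ijk(1) by auto
      then obtain z0 z1 z2 where z: "z0 \<in> B" "z1 \<in> B" "z2 \<in> B" "\<pi> z0 = i" "\<pi> z1 = j" "\<pi> z2 = k"
        by (elim imageE) simp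
      have "z0 \<noteq> z1" "z0 \<noteq> z2" "z1 \<noteq> z2" using z(4-6) I(4-6) by auto
      \<comment> \<open>Three points with distinct indices exhaust the 3-set \<open>B\<close>, so it
        is a transversal of the pairs i, j, k.\<close>
      then have "{z0, z1, z2} = B"
        by (intro card_subset_eq[OF fB(1)]) (simp_all add: z(1-3) fB(2))
      then have "br (i, j, k) B \<in> {-1, 1}"
        using bracket_transversal[OF d3[OF I], of z0 z1 z2] \<pi>x(1)[OF z(1)] \<pi>x(1)[OF z(2)]
          \<pi>x(1)[OF z(3)] z by (simp add: br_def)
      \<comment> \<open>Another bracket reaching \<open>B\<close> would have the same index set,
        hence the same increasing triple.\<close>
      moreover have "br t B = 0" if t: "t \<in> T - {(i, j, k)}" for t
      proof (rule ccontr)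
        assume nz: "br t B \<noteq> 0"
        obtain i' j' k' where t': "t = (i', j', k')" by (cases t) auto
        have "{i, j, k} = {i', j', k'}" using br_\<pi>[of i' j' k' B] nz t ijk by (simp add: t')
        from sorted_triple_eqD[OF this] ijk t show False by (auto simp: t' T_def)
      qed
      then have "(\<Sum>t \<in> T. br t B) = br (i, j, k) B"
        by (simp add: sum.remove[OF finT T])
      moreover have "edge_term p q B = 0" if s: "(p, q) \<in> set (steps C)" for p q
      proof (rule ccontr)
        assume nz: "edge_term p q B \<noteq> 0"
        obtain i' j' where "i' \<in> I" "j' \<in> I" "i' \<noteq> j'" "p = (a i', b i')" "q = (a j', b j')"
          using stepE[OF s] by auto
        with e_\<pi>[of i' j' B] nz have "card (\<pi> ` B) = 2" by simp
        with 1 show False by simp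
      qed
      then have "(\<Sum>(p, q) \<leftarrow> steps C. edge_term p q B) = 0"
        by (auto intro!: sum_list_0 simp: case_prod_unfold cong: map_cong)
      ultimately show ?thesis by (simp add: h)
    next
      case 2
      have "br t B = 0" if t: "t \<in> T" for t
      proof (rule ccontr)
        assume nz: "br t B \<noteq> 0"
        obtain i j k where t': "t = (i, j, k)" by (cases t) auto
        have "\<pi> ` B = {i, j, k}" using br_\<pi>[of i j k B] nz t by (simp add: t')
        then have "card (\<pi> ` B) = 3" using t by (auto simp: t' T_def)
        with 2 show False by simp
      qed
      then have 0: "(\<Sum>t \<in> T. br t B) = 0" by simp
      obtain i j where ij: "\<pi> ` B = {i, j}" "i \<noteq> j" using 2 by (auto simp: card_2_iff)
      have I: "i \<in> I" "j \<in> I" using \<pi>I unfolding ij(1) by simp_all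
      have sub: "B \<subseteq> {a i, b i, a j, b j}"
        using cover unfolding ij(1) by (simp add: insert_commute)
      \<comment> \<open>\<open>B\<close> is a 4-set with one point left out: a whole pair together
        with one point of the other pair.\<close>
      have "\<exists>z. z \<in> {a j, b j} \<and> B = {a i, b i, z} \<or> z \<in> {a i, b i} \<and> B = {a j, b j, z}"
      proof -
        have "\<not> {a i, b i, a j, b j} \<subseteq> B"
        proof
          assume "{a i, b i, a j, b j} \<subseteq> B"
          from card_mono[OF fB(1) this] show False
            using d2[OF I ij(2)] by (simp add: fB(2))
        qed
        then have "B \<subseteq> {a j, b j, b i} \<or> B \<subseteq> {a j, b j, a i} \<or> B \<subseteq> {a i, b i, b j} \<or> B \<subseteq> {a i, b i, a j}"
          using sub by fast
        moreover have "B = {u, v, w}" if "B \<subseteq> {u, v, w}" for u v w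
          by (rule card_seteq[OF _ that]) (simp_all add: fB(2) card_insert_if)
        ultimately show ?thesis by (metis insertCI)
      qed
      then have "edge_term (a i, b i) (a j, b j) B \<in> {-1, 1}"
        using edge_term_block[OF d2[OF I ij(2)]] edge_term_block[OF d2[OF I(2,1) ij(2)[symmetric]]]
          edge_term_swap[of "(a i, b i)" "(a j, b j)"] by fastforce
      \<comment> \<open>Both orientations are recorded, since the direction in which
        \<open>C\<close> traverses this edge is unknown.\<close>
      then have e: "edge_term (a i, b i) (a j, b j) B \<in> {-1, 1}"
        "edge_term (a j, b j) (a i, b i) B \<in> {-1, 1}"
        using edge_term_swap[of "(a i, b i)" "(a j, b j)"] by auto
      have "{(a i, b i), (a j, b j)} \<in> [V]\<^bsup>2\<^esup>"
        using I d2[OF I ij(2)] by (auto simp: assms(9) nsets_def I_def)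
      then obtain s where s: "s \<in> set (steps C)" "{fst s, snd s} = {(a i, b i), (a j, b j)}"
        unfolding C(4)[symmetric] by (auto simp: walk_edges_def)
      \<comment> \<open>Without repeated edges a step is determined by its unordered edge. So
        \<open>s\<close> is neither repeated nor reversed elsewhere in \<open>C\<close>, and only
        one step contributes to \<open>B\<close>.\<close>
      have inj_s: "inj_on (\<lambda>(p, q). {p, q}) (set (steps C))" and ds: "distinct (steps C)"
        using C(3) by (auto simp: walk_edges_def distinct_map)
      have other: "edge_term (fst s') (snd s') B = 0" if s': "s' \<in> set (steps C) - {s}" for s'
      proof (rule ccontr)
        assume nz: "edge_term (fst s') (snd s') B \<noteq> 0"
        obtain i' j' where s'_eq: "s' = ((a i', b i'), (a j', b j'))" and "i' \<in> I" "j' \<in> I" "i' \<noteq> j'"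
          using stepE s' by blast
        with e_\<pi>[of i' j' B] nz ij have "{i', j'} = {i, j}" by simp
        then have "{fst s', snd s'} = {fst s, snd s}"
          unfolding s(2) s'_eq by (auto simp: doubleton_eq_iff)
        with inj_s s' s(1) show False by (auto simp: inj_on_def case_prod_unfold)
      qed
      have "(\<Sum>(p, q) \<leftarrow> steps C. edge_term p q B) = (\<Sum>s \<in> set (steps C). edge_term (fst s) (snd s) B)"
        using ds by (simp add: sum_list_distinct_conv_sum_set case_prod_unfold)
      also have "\<dots> = edge_term (fst s) (snd s) B"
        using other s(1) by (simp add: sum.remove)
      also have "\<dots> \<in> {-1, 1}"
        using e s(2) by (auto simp: doubleton_eq_iff)
      finally show ?thesis by (simp add: h 0)
    qed
  qed

  show ?thesis by (rule halvingI[OF tr pm])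
qed

end
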